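(* For $n\ge 3$, the polynomial $P_{n,\underline{1}23}(x)=\sum_{\sigma\in S_n}x^{pmp_{\underline{1}23}(\sigma)}$ has degree $n-2$, and its coefficient of $x^{n-2}$ equals $(n-2)!$.
   Context: For $\sigma=\sigma_1\cdots\sigma_n\in S_n$, $\sigma$ has a $\underline{1}23$-match at position $\ell$ if there exist $j,m$ with $\ell<j<m$ and $\sigma_\ell<\sigma_j<\sigma_m$; $pmp_{\underline{1}23}(\sigma)$ is the number of positions $\ell$ at which $\sigma$ has a $\underline{1}23$-match. *)

theory Defs
  imports "HOL-Combinatorics.Permutations" "HOL-Computational_Algebra.Polynomial"
begin

text \<open>The word \<open>\<sigma>\<^sub>1 \<dots> \<sigma>\<^sub>n\<close> is given by a permutation \<open>\<sigma>\<close> of \<open>{1..n}\<close>, with \<open>\<sigma>\<^sub>i = \<sigma> i\<close>.\<close>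

definition match_u123 :: "nat \<Rightarrow> (nat \<Rightarrow> nat) \<Rightarrow> nat \<Rightarrow> bool" where
  "match_u123 n \<sigma> l \<longleftrightarrow>
     (\<exists>j\<in>{1..n}. \<exists>m\<in>{1..n}. l < j \<and> j < m \<and> \<sigma> l < \<sigma> j \<and> \<sigma> j < \<sigma> m)"

definition pmp_u123 :: "nat \<Rightarrow> (nat \<Rightarrow> nat) \<Rightarrow> nat" where
  "pmp_u123 n \<sigma> = card {l \<in> {1..n}. match_u123 n \<sigma> l}"

definition P_u123 :: "nat \<Rightarrow> int poly" where
  "P_u123 n = (\<Sum>\<sigma> | \<sigma> permutes {1..n}. monom 1 (pmp_u123 n \<sigma>))"

end

theory Submission
  imports Defs
begin

text \<open>The last two positions never carry a match, so every exponent is at most \<open>n - 2\<close>. If all the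
other positions carry one, then the values \<open>n - 1\<close> and \<open>n\<close>, which cannot start a match, occupy the
last two positions, and the match at position \<open>n - 2\<close> forces them to be in increasing order. Hence
the exponent \<open>n - 2\<close> is attained exactly by the permutations that fix \<open>n - 1\<close> and \<open>n\<close>, that is, by
the permutations of \<open>{1..n-2}\<close>.\<close>

lemma match_u123_position_le:
  assumes "match_u123 n \<sigma> l"
  shows "l \<le> n - 2"
  using assms unfolding match_u123_def by auto

text \<open>The counterpart for values of the bound on positions: two distinct larger values, the
  greater at most \<open>n\<close>, lie above \<open>\<sigma> l\<close>.\<close>

lemma match_u123_value_le:
  assumes "\<sigma> permutes {1..n}" "match_u123 n \<sigma> l"
  shows "\<sigma> l \<le> n - 2"
proof -
  obtain j m where "m \<in> {1..n}" "\<sigma> l < \<sigma> j" "\<sigma> j < \<sigma> m"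
    using assms(2) unfolding match_u123_def by blast
  moreover have "\<sigma> m \<in> {1..n}"
    using permutes_in_image[OF assms(1)] \<open>m \<in> {1..n}\<close> by blast
  ultimately show ?thesis by auto
qed

lemma pmp_u123_le: "pmp_u123 n \<sigma> \<le> n - 2"
proof -
  have "{l \<in> {1..n}. match_u123 n \<sigma> l} \<subseteq> {1..n-2}"
    using match_u123_position_le by auto
  then have "pmp_u123 n \<sigma> \<le> card {1..n-2}"
    unfolding pmp_u123_def by (intro card_mono) auto
  then show ?thesis by simp
qed

text \<open>The matching positions form a subset of the finite set \<open>{1..n-2}\<close>, so
  maximal cardinality forces equality of sets.\<close>

lemma pmp_u123_eq_iff_all_match:
  "pmp_u123 n \<sigma> = n - 2 \<longleftrightarrow> (\<forall>l\<in>{1..n-2}. match_u123 n \<sigma> l)"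
proof -
  have sub: "{l \<in> {1..n}. match_u123 n \<sigma> l} \<subseteq> {1..n-2}"
    using match_u123_position_le by auto
  have "pmp_u123 n \<sigma> = n - 2 \<longleftrightarrow> {l \<in> {1..n}. match_u123 n \<sigma> l} = {1..n-2}"
    unfolding pmp_u123_def using card_subset_eq[OF _ sub] by auto
  also have "\<dots> \<longleftrightarrow> (\<forall>l\<in>{1..n-2}. match_u123 n \<sigma> l)"
    using sub by auto
  finally show ?thesis .
qed

lemma all_match_u123_imp_fixes_last_two:
  assumes "n \<ge> 3" and perm: "\<sigma> permutes {1..n}"
    and all: "\<forall>l\<in>{1..n-2}. match_u123 n \<sigma> l"
  shows "\<sigma> (n - 1) = n - 1" "\<sigma> n = n"
proof -
  have last_two: "\<exists>l\<in>{n-1, n}. \<sigma> l = v" if "v \<in> {n-1, n}" for v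
  proof -
    have "v \<in> {1..n}" using that \<open>n \<ge> 3\<close> by auto
    then obtain l where l: "l \<in> {1..n}" "\<sigma> l = v"
      using permutes_image[OF perm] by (metis imageE)
    have "\<not> match_u123 n \<sigma> l"
      using match_u123_value_le[OF perm, of l] l that \<open>n \<ge> 3\<close> by auto
    then have "l \<notin> {1..n-2}" using all by blast
    with l have "l = n - 1 \<or> l = n" by auto
    then show ?thesis using l by blast
  qed
  \<comment> \<open>Only two positions lie to the right of \<open>n - 2\<close>, so \<open>j\<close>
    and \<open>m\<close> are forced.\<close>
  have "match_u123 n \<sigma> (n - 2)" using all \<open>n \<ge> 3\<close> by auto
  then obtain j m where jm: "m \<in> {1..n}" "n - 2 < j" "j < m" "\<sigma> j < \<sigma> m"
    unfolding match_u123_def by blast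
  then have "j = n - 1" "m = n" by auto
  with jm have "\<sigma> (n - 1) < \<sigma> n" by simp
  moreover have "\<sigma> (n - 1) = n - 1 \<or> \<sigma> n = n - 1" "\<sigma> (n - 1) = n \<or> \<sigma> n = n"
    using last_two[of "n - 1"] last_two[of n] by blast+
  \<comment> \<open>The only other arrangement, \<open>n\<close> followed by \<open>n - 1\<close>,
    is decreasing.\<close>
  ultimately show "\<sigma> (n - 1) = n - 1" "\<sigma> n = n"
    using \<open>n \<ge> 3\<close> by linarith+
qed

text \<open>Reduces the leading coefficient to a count of all permutations of a smaller set.\<close>

lemma permutes_pmp_u123_maximal_iff:
  assumes "n \<ge> 3"
  shows "\<sigma> permutes {1..n} \<and> pmp_u123 n \<sigma> = n - 2 \<longleftrightarrow> \<sigma> permutes {1..n-2}"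
proof
  assume *: "\<sigma> permutes {1..n} \<and> pmp_u123 n \<sigma> = n - 2"
  then have "\<sigma> (n - 1) = n - 1" "\<sigma> n = n"
    using all_match_u123_imp_fixes_last_two[OF assms] pmp_u123_eq_iff_all_match by blast+
  moreover have "x = n - 1 \<or> x = n" if "x \<in> {1..n} - {1..n-2}" for x
    using that by auto
  ultimately have "\<forall>x\<in>{1..n} - {1..n-2}. \<sigma> x = x" by metis
  then show "\<sigma> permutes {1..n-2}"
    using * permutes_superset by blast
next
  assume perm: "\<sigma> permutes {1..n-2}"
  have fixed: "\<sigma> (n - 1) = n - 1" "\<sigma> n = n"
    using assms by (auto intro!: permutes_not_in[OF perm])
  have "match_u123 n \<sigma> l" if "l \<in> {1..n-2}" for l
  proof -
    have "\<sigma> l \<in> {1..n-2}" using permutes_in_image[OF perm] that by blast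
    \<comment> \<open>The two fixed points \<open>n - 1\<close> and \<open>n\<close> serve as
      \<open>j\<close> and \<open>m\<close> for every \<open>l\<close> at once.\<close>
    then have "l < n - 1" "n - 1 < n" "\<sigma> l < \<sigma> (n - 1)" "\<sigma> (n - 1) < \<sigma> n"
      unfolding fixed using that assms by auto
    moreover have "n - 1 \<in> {1..n}" "n \<in> {1..n}" using assms by auto
    ultimately show ?thesis unfolding match_u123_def by blast
  qed
  moreover have "\<sigma> permutes {1..n}"
    using perm by (rule permutes_subset) auto
  ultimately show "\<sigma> permutes {1..n} \<and> pmp_u123 n \<sigma> = n - 2"
    using pmp_u123_eq_iff_all_match by blast
qed

lemma coeff_P_u123:
  "coeff (P_u123 n) k = int (card {\<sigma>. \<sigma> permutes {1..n} \<and> pmp_u123 n \<sigma> = k})"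
proof -
  have fin: "finite {\<sigma>. \<sigma> permutes {1..n}}" by (simp add: finite_permutations)
  have "coeff (P_u123 n) k = (\<Sum>\<sigma> | \<sigma> permutes {1..n}. if pmp_u123 n \<sigma> = k then 1 else 0)"
    by (simp add: P_u123_def coeff_sum)
  also have "\<dots> = (\<Sum>\<sigma> \<in> {\<sigma> \<in> {\<sigma>. \<sigma> permutes {1..n}}. pmp_u123 n \<sigma> = k}. 1)"
    by (rule sum.inter_filter[OF fin, symmetric])
  finally show ?thesis by simp
qed

theorem theorem4:
  fixes n :: nat
  assumes "n \<ge> 3"
  shows "degree (P_u123 n) = n - 2 \<and> coeff (P_u123 n) (n - 2) = fact (n - 2)"
proof
  show lead: "coeff (P_u123 n) (n - 2) = fact (n - 2)"
    unfolding coeff_P_u123 permutes_pmp_u123_maximal_iff[OF assms]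
    by (simp add: card_permutations)
  show "degree (P_u123 n) = n - 2"
  proof (rule antisym)
    show "degree (P_u123 n) \<le> n - 2"
      unfolding P_u123_def
      by (intro degree_sum_le)
        (auto simp: finite_permutations intro: order_trans[OF degree_monom_le] pmp_u123_le)
    \<comment> \<open>The coefficient at \<open>n - 2\<close> is a factorial, hence nonzero.\<close>
    show "n - 2 \<le> degree (P_u123 n)"
      using lead by (intro le_degree) simp
  qed
qed

end
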